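(* Let $q$ be a prime power and $n\ge1$. Let $P\subseteq K_q^n=[0,q-2]^n$ be a lattice polytope obtained from $\{0\}$ by successive application of $n$ operations, numbered $i=1,\dots,n$, where the $i$-th operation is of one of the following two types: (1) multiplication by a lattice segment $[0,a_i]$, i.e. replacing the current polytope $Q$ by $Q\times[0,a_i]$, where $a_i$ is a positive integer; (2) taking the unit pyramid and scaling the result by $k_i$, i.e. replacing the current polytope $Q$ by $k_i\mathcal{P}(Q)$, where $k_i$ is a positive integer; and where the first operation ($i=1$) is of type (1) (so that after the first step the polytope is $[0,a_1]\subset\mathbb{R}$). Let $I\subseteq\{1,\dots,n\}$ be the set of indices $i$ for which the $i$-th operation is of type (1), and let $J=\{1,\dots,n\}\setminus I$. Then the minimum distance of the toric code $\mathcal{C}_P$ over $\mathbb{F}_q$ equals $$d(\mathcal{C}_P)=(q-1)^{|J|}\prod_{i\in I}\Big(q-1-a_i\prod_{j\in J,\ j>i}k_j\Big).$$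
   Context: A lattice polytope in $\mathbb{R}^n$ is the convex hull of a finite nonempty subset of $\mathbb{Z}^n$. For a prime power $q$, put $K_q^n=[0,q-2]^n\subset\mathbb{R}^n$. For a lattice polytope $P\subseteq K_q^n$, let $\mathcal{L}(P)$ be the $\mathbb{F}_q$-vector space of polynomials spanned by the monomials $x^m=x_1^{m_1}\cdots x_n^{m_n}$ with $m=(m_1,\dots,m_n)\in P\cap\mathbb{Z}^n$. The toric code $\mathcal{C}_P$ is the linear code of block length $(q-1)^n$ over $\mathbb{F}_q$ consisting of the vectors $(f(\xi))_{\xi\in(\mathbb{F}_q^* )^n}$ for $f\in\mathcal{L}(P)$. Its minimum distance $d(\mathcal{C}_P)$ is the minimum weight (number of nonzero coordinates) of a nonzero codeword. Equivalently, it is $d(\mathcal{C}_P)=(q-1)^n-\max_{0\ne f\in\mathcal{L}(P)}Z(f)$, where $Z(f)$ is the number of points of $(\mathbb{F}_q^* )^n$ at which $f$ vanishes. The unit pyramid over a polytope $Q\subset\mathbb{R}^r$ is $\mathcal{P}(Q)=\operatorname{conv}\big(\{e_{r+1}\}\cup\{(x,0)\mid x\in Q\}\big)\subset\mathbb{R}^{r+1}$, where $e_{r+1}=(0,\dots,0,1)$, and $kQ=\{kx\mid x\in Q\}$. Empty products equal $1$. *)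

theory Defs
  imports "HOL-Analysis.Analysis" "HOL-Analysis.Finite_Function_Topology"
begin

text \<open>
  The dimension changes along the construction of the polytope, so \<open>\<real>^n\<close> is represented inside
  the real vector space \<^typ>\<open>nat \<Rightarrow>\<^sub>0 real\<close> as the finitely supported functions supported on
  \<open>{..<n}\<close>: the coordinates are numbered from \<open>0\<close>, and the embedding \<open>x \<mapsto> (x, 0)\<close> of \<open>\<real>^r\<close>
  into \<open>\<real>^(r+1)\<close> is the identity.
\<close>

definition euclid :: "nat \<Rightarrow> (nat \<Rightarrow>\<^sub>0 real) set" where
  "euclid n = {x. Poly_Mapping.keys x \<subseteq> {..<n}}"

definition lattice_polytope :: "nat \<Rightarrow> (nat \<Rightarrow>\<^sub>0 real) set \<Rightarrow> bool" where
  "lattice_polytope n P \<longleftrightarrow>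
     (\<exists>A. finite A \<and> A \<noteq> {} \<and> A \<subseteq> euclid n \<and>
          (\<forall>x\<in>A. \<forall>i. Poly_Mapping.lookup x i \<in> \<int>) \<and> P = convex hull A)"

definition cube :: "nat \<Rightarrow> nat \<Rightarrow> (nat \<Rightarrow>\<^sub>0 real) set" where
  "cube q n = {x \<in> euclid n. \<forall>i<n. 0 \<le> Poly_Mapping.lookup x i \<and>
                                    Poly_Mapping.lookup x i \<le> real q - 2}"

text \<open>
  In the next two definitions \<open>r\<close> is the dimension of the space containing \<open>Q\<close>, so that
  \<open>Poly_Mapping.single r t\<close> is \<open>t\<close> times the unit vector in the new coordinate direction.
\<close>

definition times_segment :: "nat \<Rightarrow> (nat \<Rightarrow>\<^sub>0 real) set \<Rightarrow> nat \<Rightarrow> (nat \<Rightarrow>\<^sub>0 real) set" where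
  "times_segment r Q a = {x + Poly_Mapping.single r t | x t. x \<in> Q \<and> t \<in> {0..real a}}"

definition unit_pyramid :: "nat \<Rightarrow> (nat \<Rightarrow>\<^sub>0 real) set \<Rightarrow> (nat \<Rightarrow>\<^sub>0 real) set" where
  "unit_pyramid r Q = convex hull (insert (Poly_Mapping.single r 1) Q)"

definition dilate :: "nat \<Rightarrow> (nat \<Rightarrow>\<^sub>0 real) set \<Rightarrow> (nat \<Rightarrow>\<^sub>0 real) set" where
  "dilate k Q = (\<lambda>x. real k *\<^sub>R x) ` Q"

text \<open>
  Polynomials are finitely supported functions from exponent vectors to coefficients; the product
  of \<^typ>\<open>(nat \<Rightarrow>\<^sub>0 nat) \<Rightarrow>\<^sub>0 'a\<close> is the product of polynomials, and
  \<open>Poly_Mapping.single 0 c\<close> is the constant polynomial \<open>c\<close>.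
\<close>

type_synonym 'a mpolynomial = "(nat \<Rightarrow>\<^sub>0 nat) \<Rightarrow>\<^sub>0 'a"

definition poly_scale :: "'a::field \<Rightarrow> 'a mpolynomial \<Rightarrow> 'a mpolynomial" where
  "poly_scale c f = Poly_Mapping.single 0 c * f"

global_interpretation mpoly: vector_space "poly_scale :: 'a::field \<Rightarrow> 'a mpolynomial \<Rightarrow> 'a mpolynomial"
  defines mpoly_span = mpoly.span
proof
  show "poly_scale a (x + y) = poly_scale a x + poly_scale a y"
    for a :: 'a and x y :: "'a mpolynomial"
    by (simp add: poly_scale_def distrib_left)
  show "poly_scale (a + b) x = poly_scale a x + poly_scale b x"
    for a b :: 'a and x :: "'a mpolynomial"
    by (simp add: poly_scale_def single_add distrib_right)
  show "poly_scale a (poly_scale b x) = poly_scale (a * b) x"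
    for a b :: 'a and x :: "'a mpolynomial"
    by (simp add: poly_scale_def mult_single flip: mult.assoc)
  show "poly_scale 1 x = x" for x :: "'a mpolynomial"
    by (simp add: poly_scale_def)
qed

text \<open>
  Lattice points are taken with natural number coordinates, which covers all of
  \<open>P \<inter> \<int>^n\<close> for \<open>P\<close> in the nonnegative orthant, in particular for \<open>P \<subseteq> cube q n\<close>.
\<close>

definition lattice_exponents :: "(nat \<Rightarrow>\<^sub>0 real) set \<Rightarrow> (nat \<Rightarrow>\<^sub>0 nat) set" where
  "lattice_exponents P = {m. Poly_Mapping.map real m \<in> P}"

definition poly_space :: "(nat \<Rightarrow>\<^sub>0 real) set \<Rightarrow> 'a::field mpolynomial set" where
  "poly_space P = mpoly_span ((\<lambda>m. Poly_Mapping.single m 1) ` lattice_exponents P)"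

definition poly_eval :: "'a::field mpolynomial \<Rightarrow> (nat \<Rightarrow> 'a) \<Rightarrow> 'a" where
  "poly_eval f \<xi> = (\<Sum>m\<in>Poly_Mapping.keys f. Poly_Mapping.lookup f m *
                      (\<Prod>i\<in>Poly_Mapping.keys m. \<xi> i ^ Poly_Mapping.lookup m i))"

definition torus :: "nat \<Rightarrow> (nat \<Rightarrow> 'a::field) set" where
  "torus n = {..<n} \<rightarrow>\<^sub>E (UNIV - {0})"

text \<open>
  A word with coordinates indexed by a finite set \<open>S\<close> is an extensional function on \<open>S\<close>.
\<close>

definition toric_code :: "nat \<Rightarrow> (nat \<Rightarrow>\<^sub>0 real) set \<Rightarrow> ((nat \<Rightarrow> 'a::field) \<Rightarrow> 'a) set" where
  "toric_code n P = (\<lambda>f. restrict (poly_eval f) (torus n)) ` poly_space P"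

definition weight :: "'i set \<Rightarrow> ('i \<Rightarrow> 'a::zero) \<Rightarrow> nat" where
  "weight S c = card {s \<in> S. c s \<noteq> 0}"

definition min_distance :: "'i set \<Rightarrow> ('i \<Rightarrow> 'a::zero) set \<Rightarrow> nat" where
  "min_distance S C = Min {weight S c | c. c \<in> C \<and> (\<exists>s\<in>S. c s \<noteq> 0)}"

end

theory Submission
  imports Defs "HOL-Computational_Algebra.Polynomial"
begin

text \<open>
  Along the construction one follows all dilates \<open>s Q\<^sub>i\<close> with \<open>s\<close> a natural number. Cutting \<open>s Q\<^sub>i\<close>
  with the hyperplanes on which the last coordinate is an integer \<open>j\<close> gives copies of \<open>s Q\<^bsub>i-1\<^esub>\<close>
  for \<open>j \<le> s a\<^sub>i\<close> in the product case and of \<open>(s k\<^sub>i - j) Q\<^bsub>i-1\<^esub>\<close> for \<open>j \<le> s k\<^sub>i\<close> in the pyramid case.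
  If \<open>j\<close> is the degree of a codeword in the last variable, its weight is at least
  \<open>q - 1 - j\<close> times the weight of its leading coefficient. In the pyramid case the worst case is
  \<open>j = 0\<close>: writing \<open>D s\<close> for the minimum distance of the code of \<open>s Q\<^bsub>i-1\<^esub>\<close>, the inequality
  \<open>(q - 1) D s \<le> (q - 1 - j) D (s - j)\<close> holds because \<open>D s\<close> has a factor \<open>q - 1 - s A\<close>
  with \<open>A \<ge> 1\<close> that comes from the first segment. Equality is attained by products of linear
  factors in single variables.
\<close>

section \<open>Lattice points of the polytopes\<close>

text \<open>The exponent vectors of the dilate \<open>s Q_i\<close>, described without real
  geometry. The scale \<open>s\<close> is an argument because the slices of a pyramid are dilates of
  its base by varying factors.\<close>

primrec exponents ::
  "nat set \<Rightarrow> (nat \<Rightarrow> nat) \<Rightarrow> (nat \<Rightarrow> nat) \<Rightarrow> nat \<Rightarrow> nat \<Rightarrow> (nat \<Rightarrow>\<^sub>0 nat) set" where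
  "exponents I a k 0 s = {0}"
| "exponents I a k (Suc i) s =
     (if Suc i \<in> I
      then {m + Poly_Mapping.single i j | m j. j \<le> s * a (Suc i) \<and> m \<in> exponents I a k i s}
      else {m + Poly_Mapping.single i j | m j.
              j \<le> s * k (Suc i) \<and> m \<in> exponents I a k i (s * k (Suc i) - j)})"

section \<open>Coordinates, and slicing by the last one\<close>

lemma lookup_map_real [simp]:
  "Poly_Mapping.lookup (Poly_Mapping.map real m) i = real (Poly_Mapping.lookup m i)"
  by (simp add: map.rep_eq when_def)

lemma lookup_scaleR [simp]:
  "Poly_Mapping.lookup (c *\<^sub>R x) i = c *\<^sub>R Poly_Mapping.lookup x i"
proof -
  have "finite {i. c *\<^sub>R Poly_Mapping.lookup x i \<noteq> 0}"
    by (rule finite_subset[OF _ finite_keys[of x]]) (auto simp: in_keys_iff)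
  then show ?thesis
    by (simp add: scaleR_poly_mapping_def Abs_poly_mapping_inverse)
qed

lemma lookup_euclid: "x \<in> euclid r \<Longrightarrow> r \<le> i \<Longrightarrow> Poly_Mapping.lookup x i = 0"
  by (auto simp: euclid_def in_keys_iff subset_iff)

lemma euclidI: "(\<And>i. r \<le> i \<Longrightarrow> Poly_Mapping.lookup x i = 0) \<Longrightarrow> x \<in> euclid r"
  by (auto simp: euclid_def in_keys_iff) (meson not_le)

lemma euclid_mono: "r \<le> s \<Longrightarrow> euclid r \<subseteq> euclid s"
  by (auto simp: euclid_def)

lemma add_single_in_euclid_Suc: "x \<in> euclid r \<Longrightarrow> x + Poly_Mapping.single r t \<in> euclid (Suc r)"
  by (intro euclidI) (auto simp: lookup_add lookup_single lookup_euclid)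

lemma scaleR_in_euclid: "x \<in> euclid r \<Longrightarrow> c *\<^sub>R x \<in> euclid r"
  by (intro euclidI) (simp add: lookup_euclid)

lemma convex_euclid: "convex (euclid r)"
  unfolding convex_def by (auto intro!: euclidI simp: lookup_add lookup_euclid)

text \<open>Each \<open>S t\<close> has coordinate \<open>r\<close> equal to zero, so the height
  \<open>t\<close> of a point is its coordinate \<open>r\<close>. At a lattice point it must be a
  natural number \<open>j\<close>, and removing it leaves a lattice point of
  \<open>S j\<close>.\<close>

lemma lattice_exponents_slices:
  assumes "\<And>t. t \<in> T \<Longrightarrow> S t \<subseteq> euclid r"
  shows "lattice_exponents {x + Poly_Mapping.single r t | x t. t \<in> T \<and> x \<in> S t} =
    {m + Poly_Mapping.single r j | m j. real j \<in> T \<and> m \<in> lattice_exponents (S (real j))}"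
    (is "?L = ?R")
proof (intro set_eqI iffI)
  fix m assume "m \<in> ?L"
  then obtain x t where xt: "Poly_Mapping.map real m = x + Poly_Mapping.single r t"
    and t: "t \<in> T" and x: "x \<in> S t"
    by (auto simp: lattice_exponents_def)
  have coord: "real (Poly_Mapping.lookup m i) = Poly_Mapping.lookup x i + (t when i = r)" for i
    using arg_cong[OF xt, of "\<lambda>y. Poly_Mapping.lookup y i"]
    by (simp add: lookup_add lookup_single eq_commute)
  have xr: "Poly_Mapping.lookup x r = 0"
    using x assms[OF t] by (auto intro: lookup_euclid)
  define j where "j = Poly_Mapping.lookup m r"
  define m' where "m' = m - Poly_Mapping.single r j"
  have j: "real j = t" using coord[of r] xr by (simp add: j_def)
  have m: "m = m' + Poly_Mapping.single r j"
    by (intro poly_mapping_eqI) (auto simp: m'_def j_def lookup_add lookup_minus lookup_single when_def)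
  have "Poly_Mapping.map real m' = x"
    using coord xr j
    by (intro poly_mapping_eqI) (auto simp: m'_def j_def lookup_minus lookup_single when_def)
  with x t j m show "m \<in> ?R"
    by (auto simp: lattice_exponents_def)
next
  fix m assume "m \<in> ?R"
  then obtain m' j where m: "m = m' + Poly_Mapping.single r j" and j: "real j \<in> T"
    and m': "m' \<in> lattice_exponents (S (real j))" by auto
  have "Poly_Mapping.map real m = Poly_Mapping.map real m' + Poly_Mapping.single r (real j)"
    unfolding m by (intro poly_mapping_eqI) (auto simp: lookup_add lookup_single when_def)
  with j m' show "m \<in> ?L" by (auto simp: lattice_exponents_def)
qed

section \<open>Slices of dilated prisms and pyramids\<close>

lemma single_eq_scaleR: "Poly_Mapping.single r (c * t) = c *\<^sub>R Poly_Mapping.single r (t::real)"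
  by (intro poly_mapping_eqI) (auto simp: lookup_single when_def)

lemma convex_times_segment:
  assumes "convex Q"
  shows "convex (times_segment r Q a)"
proof (rule convexI)
  fix y z and u v :: real
  assume "y \<in> times_segment r Q a" "z \<in> times_segment r Q a" and uv: "0 \<le> u" "0 \<le> v" "u + v = 1"
  then obtain x t x' t' where
    yz: "y = x + Poly_Mapping.single r t" "z = x' + Poly_Mapping.single r t'"
    and x: "x \<in> Q" "x' \<in> Q" and t: "t \<in> {0..real a}" "t' \<in> {0..real a}"
    unfolding times_segment_def by blast
  have "u *\<^sub>R y + v *\<^sub>R z = (u *\<^sub>R x + v *\<^sub>R x') + Poly_Mapping.single r (u * t + v * t')"
    by (simp add: yz single_add single_eq_scaleR scaleR_add_right)
  moreover have "u *\<^sub>R x + v *\<^sub>R x' \<in> Q"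
    using convexD[OF assms x uv] .
  moreover have "u * t + v * t' \<in> {0..real a}"
    using convexD[OF convex_real_interval(5) t uv] by simp
  ultimately show "u *\<^sub>R y + v *\<^sub>R z \<in> times_segment r Q a"
    unfolding times_segment_def by blast
qed

lemma dilate_times_segment:
  "dilate s (times_segment r Q a) =
     {x + Poly_Mapping.single r t | x t. t \<in> {0..real (s * a)} \<and> x \<in> dilate s Q}" (is "?L = ?R")
proof (intro set_eqI iffI)
  fix y assume "y \<in> ?L"
  then obtain x t where "y = real s *\<^sub>R (x + Poly_Mapping.single r t)" "x \<in> Q" "0 \<le> t" "t \<le> real a"
    by (auto simp: dilate_def times_segment_def)
  then have "y = real s *\<^sub>R x + Poly_Mapping.single r (real s * t)"
      "real s *\<^sub>R x \<in> dilate s Q" "real s * t \<in> {0..real (s * a)}"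
    by (auto simp: dilate_def single_eq_scaleR scaleR_add_right mult_left_mono)
  then show "y \<in> ?R" by blast
next
  fix y assume "y \<in> ?R"
  then obtain x t where y: "y = real s *\<^sub>R x + Poly_Mapping.single r t" "x \<in> Q"
    and t: "0 \<le> t" "t \<le> real s * real a"
    by (auto simp: dilate_def)
  \<comment> \<open>If \<open>s = 0\<close>, the bounds force \<open>t = 0\<close>, and division by
    zero yields \<open>0\<close>, which is a valid witness.\<close>
  have "t / real s \<in> {0..real a} \<and> real s * (t / real s) = t"
  proof (cases "s = 0")
    case False
    with t show ?thesis by (simp add: pos_divide_le_eq mult.commute)
  qed (use t in simp)
  then have "t / real s \<in> {0..real a}" and st: "real s * (t / real s) = t" by blast+
  moreover from st have "y = real s *\<^sub>R (x + Poly_Mapping.single r (t / real s))"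
    by (simp add: y scaleR_add_right single_eq_scaleR[symmetric] del: times_divide_eq_right)
  ultimately show "y \<in> ?L" using y(2) unfolding dilate_def times_segment_def by blast
qed

text \<open>A point of the pyramid is \<open>u\<close> times the apex plus \<open>1 - u\<close>
  times a point of \<open>Q\<close>. After scaling by \<open>s\<close> its height is
  \<open>t = s * u\<close>, and the base point carries the factor \<open>s - t\<close>. This factor
  is real, hence the image of \<open>Q\<close> instead of \<open>dilate\<close>.\<close>

lemma dilate_unit_pyramid:
  assumes "convex Q" "Q \<noteq> {}"
  shows "dilate s (unit_pyramid r Q) =
     {x + Poly_Mapping.single r t | x t. t \<in> {0..real s} \<and> x \<in> (\<lambda>x. (real s - t) *\<^sub>R x) ` Q}"
     (is "?L = ?R")
proof (intro set_eqI iffI)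
  fix y assume "y \<in> ?L"
  then obtain u v b where y: "y = real s *\<^sub>R (u *\<^sub>R Poly_Mapping.single r 1 + v *\<^sub>R b)"
    and b: "b \<in> Q" and uv: "0 \<le> u" "0 \<le> v" "u + v = 1"
    using assms by (auto simp: dilate_def unit_pyramid_def convex_hull_insert hull_same)
  have v: "v = 1 - u" using uv by simp
  have "y = (real s - real s * u) *\<^sub>R b + Poly_Mapping.single r (real s * u)"
    using single_eq_scaleR[of r "real s * u" 1]
    by (simp add: y v scaleR_add_right algebra_simps)
  moreover have "real s * u \<in> {0..real s}" using uv by (auto simp: mult_left_le)
  ultimately show "y \<in> ?R" using b by blast
next
  fix y assume "y \<in> ?R"
  then obtain b t where y: "y = (real s - t) *\<^sub>R b + Poly_Mapping.single r t" and b: "b \<in> Q"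
    and t: "0 \<le> t" "t \<le> real s" by auto
  define u where "u = t / real s"
  have u: "0 \<le> u" "u \<le> 1" "real s * u = t"
    using t by (auto simp: u_def divide_simps)
  have "y = real s *\<^sub>R (u *\<^sub>R Poly_Mapping.single r 1 + (1 - u) *\<^sub>R b)"
    using single_eq_scaleR[of r t 1] u(3)
    by (simp add: y scaleR_add_right right_diff_distrib)
  moreover have "u *\<^sub>R Poly_Mapping.single r 1 + (1 - u) *\<^sub>R b \<in> unit_pyramid r Q"
    using u b assms unfolding unit_pyramid_def convex_hull_insert[OF assms(2)]
    by (intro CollectI exI[of _ u] exI[of _ "1 - u"] exI[of _ b] conjI) (simp_all add: hull_same)
  ultimately show "y \<in> ?L" by (auto simp: dilate_def)
qed

lemma dilate_dilate: "dilate s (dilate k Q) = dilate (s * k) Q"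
  by (auto simp: dilate_def image_image)

text \<open>The slice descriptions apply at every step because the ambient space, convexity and
  nonemptiness are carried along. All scales \<open>s\<close> are treated at once, since a pyramid
  step refers to other dilates of the previous polytope.\<close>

lemma polytope_sequence:
  fixes Q :: "nat \<Rightarrow> (nat \<Rightarrow>\<^sub>0 real) set"
  assumes Q0: "Q 0 = {0}"
    and QI: "\<And>i. i \<in> {1..n} \<Longrightarrow> i \<in> I \<Longrightarrow> Q i = times_segment (i - 1) (Q (i - 1)) (a i)"
    and QJ: "\<And>i. i \<in> {1..n} \<Longrightarrow> i \<notin> I \<Longrightarrow>
      Q i = dilate (k i) (unit_pyramid (i - 1) (Q (i - 1)))"
    and "i \<le> n"
  shows "Q i \<subseteq> euclid i \<and> convex (Q i) \<and> Q i \<noteq> {} \<and>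
    (\<forall>s. lattice_exponents (dilate s (Q i)) = exponents I a k i s)"
  using \<open>i \<le> n\<close>
proof (induction i)
  case 0
  have "Poly_Mapping.map real m = 0 \<longleftrightarrow> m = 0" for m :: "nat \<Rightarrow>\<^sub>0 nat"
    by (auto simp: poly_mapping_eq_iff fun_eq_iff)
  then show ?case by (auto simp: Q0 euclid_def lattice_exponents_def dilate_def)
next
  case (Suc i)
  then have sub: "Q i \<subseteq> euclid i" and conv: "convex (Q i)" and ne: "Q i \<noteq> {}"
    and lat: "\<And>s. lattice_exponents (dilate s (Q i)) = exponents I a k i s" by auto
  have sub': "dilate s (Q i) \<subseteq> euclid i" for s
    using sub by (auto simp: dilate_def intro!: scaleR_in_euclid)
  show ?case
  proof (cases "Suc i \<in> I")
    case True
    then have Q: "Q (Suc i) = times_segment i (Q i) (a (Suc i))"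
      using QI[of "Suc i"] Suc.prems by simp
    have "convex (Q (Suc i))"
      unfolding Q by (rule convex_times_segment[OF conv])
    moreover have "Q (Suc i) \<subseteq> euclid (Suc i)"
      unfolding Q times_segment_def using sub by (auto intro: add_single_in_euclid_Suc)
    moreover have "Q (Suc i) \<noteq> {}"
    proof -
      obtain x where "x \<in> Q i" using ne by blast
      then have "x + Poly_Mapping.single i 0 \<in> Q (Suc i)"
        unfolding Q times_segment_def by (intro CollectI exI[of _ x] exI[of _ 0] conjI) auto
      then show ?thesis by blast
    qed
    moreover have "lattice_exponents (dilate s (Q (Suc i))) = exponents I a k (Suc i) s" for s
      unfolding Q dilate_times_segment
      by (subst lattice_exponents_slices[where S = "\<lambda>_. dilate s (Q i)", OF sub'])
         (simp add: lat True del: of_nat_mult)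
    ultimately show ?thesis by simp
  next
    case False
    define c where "c = k (Suc i)"
    have Q: "Q (Suc i) = dilate c (unit_pyramid i (Q i))"
      using QJ[of "Suc i"] Suc.prems False by (simp add: c_def)
    have "insert (Poly_Mapping.single i 1) (Q i) \<subseteq> euclid (Suc i)"
      using sub euclid_mono[of i "Suc i"] by (auto simp: euclid_def)
    then have "unit_pyramid i (Q i) \<subseteq> euclid (Suc i)"
      unfolding unit_pyramid_def by (intro hull_minimal convex_euclid)
    then have "Q (Suc i) \<subseteq> euclid (Suc i)"
      by (auto simp: Q dilate_def intro!: scaleR_in_euclid)
    moreover have "convex (Q (Suc i))"
      unfolding Q dilate_def unit_pyramid_def by (intro convex_scaling convex_convex_hull)
    moreover have "Q (Suc i) \<noteq> {}"
      by (simp add: Q dilate_def unit_pyramid_def)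
    moreover have "lattice_exponents (dilate s (Q (Suc i))) = exponents I a k (Suc i) s" for s
    proof -
      \<comment> \<open>At integer height the contraction factor is a natural number, so the slice
        is a genuine \<open>dilate\<close>; the bound on \<open>j\<close> makes truncated and real
        subtraction agree.\<close>
      have dil: "(\<lambda>x. (real (s * c) - real j) *\<^sub>R x) ` Q i = dilate (s * c - j) (Q i)"
        if "j \<le> s * c" for j
        unfolding dilate_def using that by (simp only: of_nat_diff)
      have "lattice_exponents (dilate s (Q (Suc i))) =
        {m + Poly_Mapping.single i j | m j. real j \<in> {0..real (s * c)} \<and>
           m \<in> lattice_exponents ((\<lambda>x. (real (s * c) - real j) *\<^sub>R x) ` Q i)}"
        unfolding Q dilate_dilate unfolding dilate_unit_pyramid[OF conv ne] using sub
        by (intro lattice_exponents_slices) (auto intro!: scaleR_in_euclid)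
      also have "\<dots> = {m + Poly_Mapping.single i j | m j. j \<le> s * c \<and>
           m \<in> lattice_exponents (dilate (s * c - j) (Q i))}"
        by (intro Collect_cong ex_cong1 conj_cong refl)
           (simp_all add: dil del: of_nat_mult)
      finally show ?thesis using False by (simp add: lat c_def)
    qed
    ultimately show ?thesis by simp
  qed
qed

section \<open>Spaces of polynomial functions\<close>

definition monomial_fun :: "(nat \<Rightarrow>\<^sub>0 nat) \<Rightarrow> (nat \<Rightarrow> 'a::field) \<Rightarrow> 'a" where
  "monomial_fun m \<xi> = (\<Prod>i\<in>Poly_Mapping.keys m. \<xi> i ^ Poly_Mapping.lookup m i)"

text \<open>Weights depend on values only, so polynomials are replaced by their functions. These are
  kept on all points, not just on the torus, so that one function can be evaluated on tori of
  different dimensions.\<close>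

definition eval_space :: "(nat \<Rightarrow>\<^sub>0 nat) set \<Rightarrow> ((nat \<Rightarrow> 'a::field) \<Rightarrow> 'a) set" where
  "eval_space E = poly_eval ` mpoly_span ((\<lambda>m. Poly_Mapping.single m 1) ` E)"

section \<open>Evaluation, and induction over spans of monomials\<close>

lemma monomial_fun_superset:
  assumes "finite A" "Poly_Mapping.keys m \<subseteq> A"
  shows "monomial_fun m \<xi> = (\<Prod>i\<in>A. \<xi> i ^ Poly_Mapping.lookup m i)"
  unfolding monomial_fun_def using assms by (intro prod.mono_neutral_left) (auto simp: in_keys_iff)

lemma monomial_fun_add: "monomial_fun (m + m') \<xi> = monomial_fun m \<xi> * monomial_fun m' \<xi>"
proof -
  let ?A = "Poly_Mapping.keys m \<union> Poly_Mapping.keys m'"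
  have "monomial_fun (m + m') \<xi> = (\<Prod>i\<in>?A. \<xi> i ^ Poly_Mapping.lookup (m + m') i)"
    by (intro monomial_fun_superset Poly_Mapping.keys_add) auto
  also have "\<dots> = monomial_fun m \<xi> * monomial_fun m' \<xi>"
    by (simp add: lookup_add power_add prod.distrib monomial_fun_superset[of ?A])
  finally show ?thesis .
qed

lemma monomial_fun_single [simp]: "monomial_fun (Poly_Mapping.single i j) \<xi> = \<xi> i ^ j"
  by (cases "j = 0") (auto simp: monomial_fun_def)

lemma monomial_fun_0 [simp]: "monomial_fun 0 \<xi> = 1"
  by (simp add: monomial_fun_def)

lemma poly_eval_superset:
  assumes "finite A" "Poly_Mapping.keys f \<subseteq> A"
  shows "poly_eval f \<xi> = (\<Sum>m\<in>A. Poly_Mapping.lookup f m * monomial_fun m \<xi>)"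
  unfolding poly_eval_def monomial_fun_def using assms
  by (intro sum.mono_neutral_left) (auto simp: in_keys_iff)

lemma poly_eval_add: "poly_eval (f + g) \<xi> = poly_eval f \<xi> + poly_eval g \<xi>"
proof -
  let ?A = "Poly_Mapping.keys f \<union> Poly_Mapping.keys g"
  have "poly_eval (f + g) \<xi> = (\<Sum>m\<in>?A. Poly_Mapping.lookup (f + g) m * monomial_fun m \<xi>)"
    by (intro poly_eval_superset Poly_Mapping.keys_add) auto
  also have "\<dots> = poly_eval f \<xi> + poly_eval g \<xi>"
    by (simp add: lookup_add distrib_right sum.distrib poly_eval_superset[of ?A])
  finally show ?thesis .
qed

lemma poly_eval_scale_single:
  "poly_eval (poly_scale c (Poly_Mapping.single m 1)) \<xi> = c * monomial_fun m \<xi>"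
  by (simp add: poly_scale_def mult_single poly_eval_superset[of "{m}"])

lemma eval_space_0: "(\<lambda>\<xi>. 0) \<in> eval_space E"
  unfolding eval_space_def
  by (rule image_eqI[OF _ mpoly.span_zero]) (simp add: poly_eval_def fun_eq_iff)

lemma eval_space_step:
  assumes "g \<in> eval_space E" "m \<in> E"
  shows "(\<lambda>\<xi>. c * monomial_fun m \<xi> + g \<xi>) \<in> eval_space E"
proof -
  obtain f where f: "f \<in> mpoly_span ((\<lambda>m. Poly_Mapping.single m 1) ` E)" "g = poly_eval f"
    using assms by (auto simp: eval_space_def)
  have "poly_scale c (Poly_Mapping.single m 1) + f \<in> mpoly_span ((\<lambda>m. Poly_Mapping.single m 1) ` E)"
    using assms(2) f(1) by (intro mpoly.span_add[OF mpoly.span_scale[OF mpoly.span_base]]) auto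
  then show ?thesis unfolding eval_space_def
    by (rule rev_image_eqI) (simp add: fun_eq_iff poly_eval_add poly_eval_scale_single f)
qed

text \<open>Span induction transferred to functions, so that the later arguments add one monomial
  function at a time.\<close>

lemma eval_space_induct [consumes 1, case_names zero step]:
  fixes g :: "(nat \<Rightarrow> 'a::field) \<Rightarrow> 'a"
  assumes "g \<in> eval_space E"
    and "P (\<lambda>\<xi>. 0)"
    and "\<And>c m g. m \<in> E \<Longrightarrow> g \<in> eval_space E \<Longrightarrow> P g \<Longrightarrow> P (\<lambda>\<xi>. c * monomial_fun m \<xi> + g \<xi>)"
  shows "P g"
proof -
  obtain f where f: "f \<in> mpoly_span ((\<lambda>m. Poly_Mapping.single m 1) ` E)" "g = poly_eval f"
    using assms by (auto simp: eval_space_def)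
  from f(1) have "poly_eval f \<in> eval_space E \<and> P (poly_eval f)"
  proof (induction rule: mpoly.span_induct_alt)
    case base
    have "poly_eval (0 :: 'a mpolynomial) = (\<lambda>\<xi>. 0)" by (simp add: poly_eval_def fun_eq_iff)
    then show ?case using assms(2) by (simp add: eval_space_0)
  next
    case (step c x y)
    then obtain m where m: "m \<in> E" "x = Poly_Mapping.single m 1" by auto
    have "poly_eval (poly_scale c x + y) = (\<lambda>\<xi>. c * monomial_fun m \<xi> + poly_eval y \<xi>)"
      by (simp add: m fun_eq_iff poly_eval_add poly_eval_scale_single)
    then show ?case using step m assms(3) by (simp add: eval_space_step)
  qed
  then show ?thesis using f by simp
qed

lemma eval_space_add:
  assumes "f \<in> eval_space E" "g \<in> eval_space E"
  shows "(\<lambda>\<xi>. f \<xi> + g \<xi>) \<in> eval_space E"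
  using assms(1)
  by (induction rule: eval_space_induct) (auto simp: assms(2) add.assoc intro: eval_space_step)

lemma eval_space_scale:
  assumes "f \<in> eval_space E"
  shows "(\<lambda>\<xi>. c * f \<xi>) \<in> eval_space E"
  using assms
proof (induction rule: eval_space_induct)
  case (step d m g)
  then show ?case
    using eval_space_step[of "\<lambda>\<xi>. c * g \<xi>" E m "c * d"] by (simp add: algebra_simps)
qed (simp add: eval_space_0)

lemma eval_space_sum:
  assumes "\<And>j. j \<in> A \<Longrightarrow> f j \<in> eval_space E"
  shows "(\<lambda>\<xi>. \<Sum>j\<in>A. f j \<xi>) \<in> eval_space E"
  using assms
  by (induction A rule: infinite_finite_induct) (auto simp: eval_space_0 intro: eval_space_add)

lemma eval_space_cong:
  assumes "g \<in> eval_space E" "\<And>m. m \<in> E \<Longrightarrow> Poly_Mapping.keys m \<subseteq> S" "\<And>i. i \<in> S \<Longrightarrow> \<xi> i = \<eta> i"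
  shows "g \<xi> = g \<eta>"
  using assms(1)
proof (induction rule: eval_space_induct)
  case (step c m g)
  have "monomial_fun m \<xi> = monomial_fun m \<eta>"
    unfolding monomial_fun_def using assms(2)[OF step(1)] assms(3) by (intro prod.cong) auto
  then show ?case using step by simp
qed simp

text \<open>Terms are collected by powers of the variable \<open>r\<close>; the coefficient of the
  \<open>j\<close>-th power uses only exponents from the slice \<open>E j\<close>.\<close>

lemma eval_space_slicesD:
  fixes d :: nat and g :: "(nat \<Rightarrow> 'a::field) \<Rightarrow> 'a"
  assumes "g \<in> eval_space {m + Poly_Mapping.single r j | m j. j \<le> d \<and> m \<in> E j}"
  shows "\<exists>f. (\<forall>j. f j \<in> eval_space (E j)) \<and> (\<forall>\<xi>. g \<xi> = (\<Sum>j\<le>d. f j \<xi> * \<xi> r ^ j))"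
  using assms
proof (induction rule: eval_space_induct)
  case zero
  show ?case by (intro exI[of _ "\<lambda>_ _. 0"]) (simp add: eval_space_0)
next
  case (step c m g)
  then obtain m' j where m: "m = m' + Poly_Mapping.single r j" and j: "j \<le> d" and m': "m' \<in> E j"
    by auto
  obtain f where f: "\<And>j. f j \<in> eval_space (E j)" "\<And>\<xi>. g \<xi> = (\<Sum>j\<le>d. f j \<xi> * \<xi> r ^ j)"
    using step.IH by blast
  \<comment> \<open>The new monomial is absorbed by the coefficient of its own power
    \<open>j\<close>.\<close>
  define f' where "f' l = (if l = j then \<lambda>\<xi>. c * monomial_fun m' \<xi> + f j \<xi> else f l)" for l
  have "f' l \<in> eval_space (E l)" for l
    using f(1) m' by (auto simp: f'_def intro: eval_space_step)
  moreover have "c * monomial_fun m \<xi> + g \<xi> = (\<Sum>l\<le>d. f' l \<xi> * \<xi> r ^ l)" for \<xi>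
  proof -
    have "(\<Sum>l\<le>d. f' l \<xi> * \<xi> r ^ l) =
        (\<Sum>l\<le>d. (if l = j then c * monomial_fun m' \<xi> * \<xi> r ^ j else 0) + f l \<xi> * \<xi> r ^ l)"
      by (intro sum.cong) (auto simp: f'_def distrib_right)
    also have "\<dots> = c * monomial_fun m \<xi> + g \<xi>"
      using j by (simp add: sum.distrib f(2) m monomial_fun_add mult.assoc)
    finally show ?thesis by simp
  qed
  ultimately show ?case by blast
qed

lemma eval_space_slicesI:
  fixes d :: nat and f :: "(nat \<Rightarrow> 'a::field) \<Rightarrow> 'a"
  assumes "f \<in> eval_space (E j)" "j \<le> d"
  shows "(\<lambda>\<xi>. f \<xi> * \<xi> r ^ j) \<in> eval_space {m + Poly_Mapping.single r j | m j. j \<le> d \<and> m \<in> E j}"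
  using assms(1)
proof (induction rule: eval_space_induct)
  case (step c m g)
  have "(\<lambda>\<xi>. (c * monomial_fun m \<xi> + g \<xi>) * \<xi> r ^ j) =
      (\<lambda>\<xi>. c * monomial_fun (m + Poly_Mapping.single r j) \<xi> + g \<xi> * \<xi> r ^ j)"
    by (simp add: fun_eq_iff monomial_fun_add algebra_simps)
  then show ?case using step assms(2) eval_space_step[OF step(3)] by auto
qed (simp add: eval_space_0)

section \<open>Weights\<close>

lemma finite_torus: "finite (torus r :: (nat \<Rightarrow> 'a::{field,finite}) set)"
  by (simp add: torus_def finite_PiE)

text \<open>The torus fibres over its first \<open>r\<close> coordinates, and nonzero values are
  counted fibre by fibre.\<close>

lemma weight_torus_Suc:
  fixes g :: "(nat \<Rightarrow> 'a::{field,finite}) \<Rightarrow> 'a"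
  shows "weight (torus (Suc r)) g = (\<Sum>\<xi>\<in>torus r. card {t. t \<noteq> 0 \<and> g (\<xi>(r := t)) \<noteq> 0})"
proof -
  let ?S = "SIGMA \<xi>:torus r. {t. t \<noteq> 0 \<and> g (\<xi>(r := t)) \<noteq> 0}"
  let ?h = "\<lambda>(\<xi>, t). \<xi>(r := t)"
  have torus: "torus (Suc r) = (\<lambda>(t, \<xi>). \<xi>(r := t)) ` ((UNIV - {0}) \<times> torus r)"
    unfolding torus_def lessThan_Suc by (rule PiE_insert_eq)
  have "inj_on (\<lambda>(t, \<xi>). \<xi>(r := t)) ((UNIV - {0::'a}) \<times> torus r)"
    unfolding torus_def by (rule inj_combinator) simp
  then have inj: "inj_on ?h ?S"
    unfolding inj_on_def by auto
  have "{\<eta> \<in> torus (Suc r). g \<eta> \<noteq> 0} = ?h ` ?S"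
    unfolding torus by force
  then show ?thesis
    unfolding weight_def by (simp add: card_image[OF inj] finite_torus)
qed

lemma card_nonzero: "card {t::'a::{field,finite}. t \<noteq> 0} = CARD('a) - 1"
proof -
  have "{t::'a. t \<noteq> 0} = UNIV - {0}" by auto
  then show ?thesis by (simp add: card_Diff_subset)
qed

lemma weight_mult_last:
  fixes f :: "(nat \<Rightarrow> 'a::{field,finite}) \<Rightarrow> 'a"
  assumes "\<And>\<xi> t. f (\<xi>(r := t)) = f \<xi>"
  shows "weight (torus (Suc r)) (\<lambda>\<xi>. f \<xi> * h (\<xi> r)) = weight (torus r) f * card {t. t \<noteq> 0 \<and> h t \<noteq> 0}"
proof -
  have "weight (torus (Suc r)) (\<lambda>\<xi>. f \<xi> * h (\<xi> r)) =
      (\<Sum>\<xi>\<in>torus r. if f \<xi> \<noteq> 0 then card {t. t \<noteq> 0 \<and> h t \<noteq> 0} else 0)"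
    unfolding weight_torus_Suc by (intro sum.cong) (auto simp: assms)
  also have "\<dots> = (\<Sum>\<xi>\<in>{\<xi>\<in>torus r. f \<xi> \<noteq> 0}. card {t. t \<noteq> 0 \<and> h t \<noteq> 0})"
    by (rule sum.inter_filter[symmetric]) (rule finite_torus)
  finally show ?thesis by (simp add: weight_def)
qed

text \<open>
  At a point where the leading coefficient in the last variable does not vanish, there are at most
  as many zeros as the degree in that variable.
\<close>

lemma weight_torus_Suc_ge:
  fixes g :: "(nat \<Rightarrow> 'a::{field,finite}) \<Rightarrow> 'a" and d :: nat
  assumes g: "\<And>\<xi>. g \<xi> = (\<Sum>j\<le>d. f j \<xi> * \<xi> r ^ j)"
    and f: "\<And>j \<xi> t. f j (\<xi>(r := t)) = f j \<xi>"
    and nz: "\<exists>\<xi>\<in>torus (Suc r). g \<xi> \<noteq> 0"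
  obtains j where "j \<le> d" "\<exists>\<xi>\<in>torus r. f j \<xi> \<noteq> 0"
    "weight (torus r) (f j) * (CARD('a) - 1 - j) \<le> weight (torus (Suc r)) g"
proof -
  define A where "A = {j. j \<le> d \<and> (\<exists>\<xi>\<in>torus r. f j \<xi> \<noteq> 0)}"
  have fin: "finite A" by (rule finite_subset[of _ "{..d}"]) (auto simp: A_def)
  have "A \<noteq> {}"
  proof
    assume "A = {}"
    then have "f j \<xi> = 0" if "j \<le> d" "\<xi> \<in> torus r" for j \<xi> using that by (auto simp: A_def)
    moreover obtain \<eta> where \<eta>: "\<eta> \<in> torus (Suc r)" "g \<eta> \<noteq> 0" using nz by blast
    \<comment> \<open>Points of \<open>torus r\<close> are extensional, so coordinate
      \<open>r\<close> is reset to \<open>undefined\<close>; the coefficients do not see this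
      change.\<close>
    then have "\<eta>(r := undefined) \<in> torus r"
      by (auto simp: torus_def PiE_def Pi_def extensional_def less_Suc_eq)
    ultimately have "f j \<eta> = 0" if "j \<le> d" for j
      using f[of j \<eta> undefined] that by metis
    with \<eta>(2) show False by (simp add: g)
  qed
  \<comment> \<open>The largest power whose coefficient is not identically zero on the torus; on
    every fibre \<open>g\<close> is then a polynomial of degree at most \<open>j\<close>.\<close>
  define j where "j = Max A"
  have "j \<in> A" unfolding j_def using fin \<open>A \<noteq> {}\<close> by (rule Max_in)
  then have j: "j \<le> d" "\<exists>\<xi>\<in>torus r. f j \<xi> \<noteq> 0" by (auto simp: A_def)
  have top: "f l \<xi> = 0" if "l \<le> d" "j < l" "\<xi> \<in> torus r" for l \<xi>
  proof (rule ccontr)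
    assume "f l \<xi> \<noteq> 0"
    with that have "l \<in> A" by (auto simp: A_def)
    then have "l \<le> j" unfolding j_def by (rule Max_ge[OF fin])
    with that show False by simp
  qed
  have roots: "CARD('a) - 1 - j \<le> card {t. t \<noteq> 0 \<and> g (\<xi>(r := t)) \<noteq> 0}"
    if \<xi>: "\<xi> \<in> torus r" "f j \<xi> \<noteq> 0" for \<xi>
  proof -
    define p where "p = (\<Sum>l\<le>j. monom (f l \<xi>) l)"
    have p: "g (\<xi>(r := t)) = poly p t" for t
    proof -
      have "g (\<xi>(r := t)) = (\<Sum>l\<le>d. f l \<xi> * t ^ l)" by (simp add: g f)
      also have "\<dots> = (\<Sum>l\<le>j. f l \<xi> * t ^ l)"
        using j(1) top \<xi>(1) by (intro sum.mono_neutral_right) auto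
      finally show ?thesis by (simp add: p_def poly_sum poly_monom)
    qed
    have "coeff p j = f j \<xi>" by (simp add: p_def coeff_sum)
    then have "p \<noteq> 0" using \<xi>(2) by auto
    have "degree p \<le> j"
      unfolding p_def by (intro degree_sum_le) (auto intro: order_trans[OF degree_monom_le])
    then have "card {t. poly p t = 0} \<le> j"
      using card_poly_roots_bound[OF \<open>p \<noteq> 0\<close>] by linarith
    then have "CARD('a) - 1 - j \<le> card {t::'a. t \<noteq> 0} - card {t. poly p t = 0}"
      by (simp add: card_nonzero)
    also have "\<dots> \<le> card ({t. t \<noteq> 0} - {t. poly p t = 0})"
      by (rule diff_card_le_card_Diff) simp
    also have "{t. t \<noteq> 0} - {t. poly p t = 0} = {t. t \<noteq> 0 \<and> g (\<xi>(r := t)) \<noteq> 0}"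
      by (auto simp: p)
    finally show ?thesis .
  qed
  have "weight (torus r) (f j) * (CARD('a) - 1 - j) =
      (\<Sum>\<xi>\<in>{\<xi>\<in>torus r. f j \<xi> \<noteq> 0}. CARD('a) - 1 - j)"
    by (simp add: weight_def)
  also have "\<dots> \<le> (\<Sum>\<xi>\<in>{\<xi>\<in>torus r. f j \<xi> \<noteq> 0}. card {t. t \<noteq> 0 \<and> g (\<xi>(r := t)) \<noteq> 0})"
    by (intro sum_mono roots) auto
  \<comment> \<open>Fibres on which the leading coefficient vanishes are simply discarded.\<close>
  also have "\<dots> \<le> weight (torus (Suc r)) g"
    unfolding weight_torus_Suc by (intro sum_mono2 finite_torus) auto
  finally show thesis using that j by blast
qed

section \<open>The minimum distance\<close>

text \<open>
  The subtraction is truncated: a factor \<open>N - s * a\<close> that would be negative counts as \<open>0\<close>, so that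
  the lower bound on weights holds without assuming that the polytope fits into the cube.
\<close>

primrec distance :: "nat set \<Rightarrow> (nat \<Rightarrow> nat) \<Rightarrow> (nat \<Rightarrow> nat) \<Rightarrow> nat \<Rightarrow> nat \<Rightarrow> nat \<Rightarrow> nat" where
  "distance I a k N 0 s = 1"
| "distance I a k N (Suc i) s =
     (if Suc i \<in> I then distance I a k N i s * (N - s * a (Suc i))
      else N * distance I a k N i (s * k (Suc i)))"

section \<open>Trade-off between degree and scale, and the bounds on weights\<close>

lemma keys_exponents: "m \<in> exponents I a k i s \<Longrightarrow> Poly_Mapping.keys m \<subseteq> {..<i}"
proof (induction i arbitrary: m s)
  case (Suc i)
  then obtain m' j s' where "m = m' + Poly_Mapping.single i j" "m' \<in> exponents I a k i s'"
    by (auto split: if_splits)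
  with Suc.IH[of m' s'] Poly_Mapping.keys_add[of m' "Poly_Mapping.single i j"] show ?case
    by (fastforce split: if_splits)
qed simp

lemma eval_space_exponents_upd:
  "g \<in> eval_space (exponents I a k i s) \<Longrightarrow> g (\<xi>(i := t)) = g \<xi>"
  by (rule eval_space_cong[where S = "{..<i}"]) (auto dest: keys_exponents)

text \<open>If \<open>N <= s * A\<close>, truncation makes the left side zero. Otherwise put
  \<open>p = N - s * A\<close>; the claim becomes \<open>j * (p + j * A) <= j * (N * A)\<close>. It
  holds since \<open>1 <= A\<close> and \<open>j <= s * A\<close> give
  \<open>p + j * A <= p * A + s * A * A = N * A\<close>.\<close>

lemma segment_trade_off:
  fixes N A s j :: nat
  assumes "A > 0" "j \<le> s"
  shows "N * (N - s * A) \<le> (N - j) * (N - (s - j) * A)"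
proof (cases "s * A < N")
  case True
  define p where "p = N - s * A"
  have N: "N = s * A + p" using True by (simp add: p_def)
  have "j \<le> s * A" using assms by (metis le_trans mult.right_neutral mult_le_mono2 Suc_leI One_nat_def)
  have "N - (s - j) * A = p + j * A"
    using assms by (simp add: N diff_mult_distrib)
  moreover have "N * p + j * (p + j * A) \<le> N * (p + j * A)"
  proof -
    have "p + j * A \<le> p * A + (s * A) * A"
      using assms by (intro add_mono mult_le_mono \<open>j \<le> s * A\<close>) auto
    also have "\<dots> = N * A" by (simp add: N algebra_simps)
    finally have "j * (p + j * A) \<le> j * (N * A)" by simp
    then show ?thesis by (simp add: algebra_simps)
  qed
  ultimately show ?thesis
    by (simp add: diff_mult_distrib p_def[symmetric])
qed simp

text \<open>The first segment gives the base case. A later segment only adds a factor that grows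
  when the scale drops. A pyramid step with factor \<open>c\<close> uses the induction hypothesis
  for \<open>s * c\<close> and \<open>j * c\<close>, together with \<open>j <= j * c\<close>. The
  index is \<open>Suc i\<close> because at index 0 the distance is constantly 1 and nothing
  compensates the loss from \<open>N\<close> to \<open>N - j\<close>.\<close>

lemma distance_trade_off:
  assumes "1 \<in> I" "a 1 > 0" "\<And>j. j \<in> {1..n} \<Longrightarrow> j \<notin> I \<Longrightarrow> k j > 0" "Suc i \<le> n" "j \<le> s"
  shows "N * distance I a k N (Suc i) s \<le> (N - j) * distance I a k N (Suc i) (s - j)"
  using assms(4,5)
proof (induction i arbitrary: s j)
  case 0
  then show ?case using assms(1,2) segment_trade_off[of "a 1" j s N] by simp
next
  case (Suc i)
  let ?D = "distance I a k N (Suc i)"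
  show ?case
  proof (cases "Suc (Suc i) \<in> I")
    case True
    have "N * ?D s * (N - s * a (Suc (Suc i))) \<le>
        (N - j) * ?D (s - j) * (N - (s - j) * a (Suc (Suc i)))"
      using Suc.prems by (intro mult_le_mono[OF Suc.IH diff_le_mono2] mult_le_mono1) auto
    then show ?thesis using True by (simp add: mult.assoc del: distance.simps(2) add: distance.simps(2)[of _ _ _ _ "Suc i"])
  next
    case False
    let ?c = "k (Suc (Suc i))"
    have "?c > 0" using assms(3)[of "Suc (Suc i)"] Suc.prems False by auto
    have "N * ?D (s * ?c) \<le> (N - j * ?c) * ?D (s * ?c - j * ?c)"
      using Suc by (intro Suc.IH) auto
    also have "\<dots> \<le> (N - j) * ?D ((s - j) * ?c)"
      using \<open>?c > 0\<close> by (intro mult_le_mono diff_le_mono2) (auto simp: diff_mult_distrib)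
    finally have "N * (N * ?D (s * ?c)) \<le> N * ((N - j) * ?D ((s - j) * ?c))"
      by (rule mult_le_mono2)
    then show ?thesis using False
      by (simp add: mult.left_commute del: distance.simps(2) add: distance.simps(2)[of _ _ _ _ "Suc i"])
  qed
qed

text \<open>The last variable is peeled off and the induction hypothesis applied to the leading
  coefficient. In a segment step all coefficients lie in the same code, so the top degree is the
  worst case; in a pyramid step the trade-off covers every degree \<open>j\<close>.\<close>

lemma distance_le_weight:
  fixes g :: "(nat \<Rightarrow> 'a::{field,finite}) \<Rightarrow> 'a"
  assumes "1 \<in> I" "a 1 > 0" "\<And>j. j \<in> {1..n} \<Longrightarrow> j \<notin> I \<Longrightarrow> k j > 0" "i \<le> n"
    and "g \<in> eval_space (exponents I a k i s)" "\<exists>\<xi>\<in>torus i. g \<xi> \<noteq> 0"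
  shows "distance I a k (CARD('a) - 1) i s \<le> weight (torus i) g"
  using assms(4-6)
proof (induction i arbitrary: s g)
  case 0
  then have "card {\<xi> \<in> torus 0. g \<xi> \<noteq> 0} > 0"
    by (subst card_gt_0_iff) (auto simp: finite_torus)
  then show ?case by (simp add: weight_def)
next
  case (Suc i)
  let ?N = "CARD('a) - 1"
  let ?D = "distance I a k ?N"
  show ?case
  proof (cases "Suc i \<in> I")
    case True
    then have "g \<in> eval_space {m + Poly_Mapping.single i j | m j.
        j \<le> s * a (Suc i) \<and> m \<in> exponents I a k i s}"
      using Suc.prems by simp
    from eval_space_slicesD[OF this] obtain f where
      f: "\<And>j. f j \<in> eval_space (exponents I a k i s)"
      and g: "\<And>\<xi>. g \<xi> = (\<Sum>j\<le>s * a (Suc i). f j \<xi> * \<xi> i ^ j)" by blast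
    obtain j where j: "j \<le> s * a (Suc i)" "\<exists>\<xi>\<in>torus i. f j \<xi> \<noteq> 0"
      and w: "weight (torus i) (f j) * (?N - j) \<le> weight (torus (Suc i)) g"
      using weight_torus_Suc_ge[OF g eval_space_exponents_upd[OF f] Suc.prems(3)] .
    have "?D i s \<le> weight (torus i) (f j)"
      using Suc.IH[OF _ f j(2)] Suc.prems by simp
    then have "?D i s * (?N - s * a (Suc i)) \<le> weight (torus i) (f j) * (?N - j)"
      using j(1) by (intro mult_le_mono diff_le_mono2)
    with w True show ?thesis by simp
  next
    case False
    \<comment> \<open>The first operation is a segment, so a pyramid is preceded by at least one
      step, as the trade-off requires.\<close>
    then have "i \<noteq> 0" using assms(1) by (metis One_nat_def)
    then obtain i' where i': "i = Suc i'" by (cases i) auto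
    have "g \<in> eval_space {m + Poly_Mapping.single i j | m j.
        j \<le> s * k (Suc i) \<and> m \<in> exponents I a k i (s * k (Suc i) - j)}"
      using Suc.prems False by simp
    from eval_space_slicesD[OF this] obtain f where
      f: "\<And>j. f j \<in> eval_space (exponents I a k i (s * k (Suc i) - j))"
      and g: "\<And>\<xi>. g \<xi> = (\<Sum>j\<le>s * k (Suc i). f j \<xi> * \<xi> i ^ j)" by blast
    obtain j where j: "j \<le> s * k (Suc i)" "\<exists>\<xi>\<in>torus i. f j \<xi> \<noteq> 0"
      and w: "weight (torus i) (f j) * (?N - j) \<le> weight (torus (Suc i)) g"
      using weight_torus_Suc_ge[OF g eval_space_exponents_upd[OF f] Suc.prems(3)] .
    have "?N * ?D i (s * k (Suc i)) \<le> (?N - j) * ?D i (s * k (Suc i) - j)"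
      unfolding i' using assms(1-3) Suc.prems(1) j(1) i'
      by (intro distance_trade_off[where n = n]) auto
    also have "\<dots> \<le> (?N - j) * weight (torus i) (f j)"
      using Suc.IH[OF _ f j(2)] Suc.prems by simp
    finally show ?thesis using w False by (simp add: mult.commute)
  qed
qed

text \<open>A segment step multiplies by linear factors in the new variable with
  \<open>s * a (Suc i)\<close> distinct nonzero roots, which exist because positivity forces
  \<open>s * a (Suc i) < CARD('a) - 1\<close>. A pyramid step keeps the function, constant in the
  new variable.\<close>

lemma distance_attained:
  assumes "distance I a k (CARD('a) - 1) i s > 0"
  shows "\<exists>g :: (nat \<Rightarrow> 'a::{field,finite}) \<Rightarrow> 'a. g \<in> eval_space (exponents I a k i s) \<and>
    weight (torus i) g = distance I a k (CARD('a) - 1) i s"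
  using assms
proof (induction i arbitrary: s)
  case 0
  have "(\<lambda>\<xi>. 1 :: 'a) \<in> eval_space (exponents I a k 0 s)"
    using eval_space_step[OF eval_space_0, of 0 "exponents I a k 0 s" 1] by simp
  moreover have "weight (torus 0) (\<lambda>\<xi>. 1 :: 'a) = 1"
    by (simp add: weight_def torus_def)
  ultimately show ?case by auto
next
  case (Suc i)
  let ?N = "CARD('a) - 1"
  let ?D = "distance I a k ?N"
  show ?case
  proof (cases "Suc i \<in> I")
    case True
    let ?d = "s * a (Suc i)"
    have pos: "?D i s > 0" "?d < ?N" using Suc.prems True by auto
    obtain g :: "(nat \<Rightarrow> 'a) \<Rightarrow> 'a" where g: "g \<in> eval_space (exponents I a k i s)"
      and w: "weight (torus i) g = ?D i s" using Suc.IH[OF pos(1)] by blast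
    obtain T where T: "T \<subseteq> {t::'a. t \<noteq> 0}" "card T = ?d"
      using obtain_subset_with_card_n[of ?d "{t::'a. t \<noteq> 0}"] pos(2) by (auto simp: card_nonzero)
    define p where "p = (\<Prod>t\<in>T. [:- t, 1:])"
    have "degree p = ?d"
      unfolding p_def by (subst degree_prod_sum_eq) (auto simp: T)
    then have "(\<lambda>\<xi>. g \<xi> * poly p (\<xi> i)) = (\<lambda>\<xi>. \<Sum>j\<le>?d. coeff p j * (g \<xi> * \<xi> i ^ j))"
      by (simp add: fun_eq_iff poly_altdef sum_distrib_left mult_ac)
    also have "\<dots> \<in> eval_space {m + Poly_Mapping.single i j | m j. j \<le> ?d \<and> m \<in> exponents I a k i s}"
      using g by (intro eval_space_sum eval_space_scale eval_space_slicesI) auto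
    finally have "(\<lambda>\<xi>. g \<xi> * poly p (\<xi> i)) \<in> eval_space (exponents I a k (Suc i) s)"
      using True by simp
    moreover have "{t. t \<noteq> 0 \<and> poly p t \<noteq> 0} = {t. t \<noteq> 0} - T"
      by (auto simp: p_def poly_prod)
    then have "card {t. t \<noteq> 0 \<and> poly p t \<noteq> 0} = ?N - ?d"
      using T by (simp add: card_Diff_subset card_nonzero)
    then have "weight (torus (Suc i)) (\<lambda>\<xi>. g \<xi> * poly p (\<xi> i)) = ?D (Suc i) s"
      using True by (simp add: weight_mult_last eval_space_exponents_upd[OF g] w)
    ultimately show ?thesis by blast
  next
    case False
    let ?d = "s * k (Suc i)"
    have "?D i ?d > 0" using Suc.prems False by simp
    then obtain g :: "(nat \<Rightarrow> 'a) \<Rightarrow> 'a" where g: "g \<in> eval_space (exponents I a k i ?d)"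
      and w: "weight (torus i) g = ?D i ?d" using Suc.IH by blast
    \<comment> \<open>The slice at height 0 is the full dilate of the base by
      \<open>?d\<close>.\<close>
    have "g \<in> eval_space (exponents I a k (Suc i) s)"
      using False eval_space_slicesI[of g "\<lambda>j. exponents I a k i (?d - j)" 0 ?d i] g by simp
    moreover have "weight (torus (Suc i)) g = ?D (Suc i) s"
      using False weight_mult_last[of g i "\<lambda>_. 1"]
      by (simp add: eval_space_exponents_upd[OF g] w card_nonzero)
    ultimately show ?thesis by blast
  qed
qed

section \<open>Positivity, closed form, and passage to the code\<close>

lemma zero_in_exponents: "0 \<in> exponents I a k i s"
proof (induction i arbitrary: s)
  case (Suc i)
  have "(0 :: nat \<Rightarrow>\<^sub>0 nat) = 0 + Poly_Mapping.single i 0" by simp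
  with Suc.IH show ?case by (auto intro!: exI[of _ 0])
qed simp

text \<open>The origin shifted by \<open>s * a (Suc i)\<close> in the new direction is a lattice
  point, so the coordinate bound makes each segment factor positive. Slices at height 0 pass the
  bound on to the previous polytope.\<close>

lemma distance_pos:
  assumes "N > 0" "\<And>m l. m \<in> exponents I a k i s \<Longrightarrow> Poly_Mapping.lookup m l < N"
  shows "distance I a k N i s > 0"
  using assms(2)
proof (induction i arbitrary: s)
  case (Suc i)
  show ?case
  proof (cases "Suc i \<in> I")
    case True
    have mem: "m + Poly_Mapping.single i j \<in> exponents I a k (Suc i) s"
      if "m \<in> exponents I a k i s" "j \<le> s * a (Suc i)" for m j
      using True that by auto
    have "distance I a k N i s > 0"
      using mem[of _ 0] Suc.prems by (intro Suc.IH) simp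
    moreover have "s * a (Suc i) < N"
      using Suc.prems[OF mem[OF zero_in_exponents order_refl], of i] by simp
    ultimately show ?thesis using True by simp
  next
    case False
    have "m \<in> exponents I a k (Suc i) s" if "m \<in> exponents I a k i (s * k (Suc i))" for m
      using False that by (auto intro!: exI[of _ m] exI[of _ "0 :: nat"])
    then show ?thesis using False Suc assms(1) by simp
  qed
qed simp

text \<open>Each pyramid step multiplies the scale seen by all earlier segments, so the factor of
  segment \<open>l\<close> collects the \<open>k j\<close> with \<open>j > l\<close>. Positivity
  rules out truncation, and the factors become integer differences.\<close>

lemma distance_eq:
  assumes "distance I a k N i s > 0"
  shows "int (distance I a k N i s) = int N ^ card ({1..i} - I) *
    (\<Prod>l\<in>I \<inter> {1..i}. int N - int s * int (a l) * (\<Prod>j\<in>{j \<in> {1..i} - I. j > l}. int (k j)))"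
  using assms
proof (induction i arbitrary: s)
  case (Suc i)
  show ?case
  proof (cases "Suc i \<in> I")
    case True
    then have pos: "distance I a k N i s > 0" "s * a (Suc i) < N" using Suc.prems by auto
    have sets: "{1..Suc i} - I = {1..i} - I" "I \<inter> {1..Suc i} = insert (Suc i) (I \<inter> {1..i})"
      using True by (auto simp: le_Suc_eq)
    \<comment> \<open>No pyramid comes after the new segment yet, so its product is empty.\<close>
    have "(\<Prod>j | 1 \<le> j \<and> j \<le> i \<and> j \<notin> I \<and> Suc i < j. int (k j)) = 1"
      by (rule prod.neutral) auto
    then show ?thesis using Suc.IH[OF pos(1)] True pos(2)
      by (simp add: sets of_nat_diff del: One_nat_def)
  next
    case False
    then have pos: "distance I a k N i (s * k (Suc i)) > 0" using Suc.prems by auto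
    have sets: "{1..Suc i} - I = insert (Suc i) ({1..i} - I)" "I \<inter> {1..Suc i} = I \<inter> {1..i}"
      using False by (auto simp: le_Suc_eq)
    have split: "(\<Prod>j\<in>{j \<in> insert (Suc i) ({1..i} - I). j > l}. int (k j)) =
        int (k (Suc i)) * (\<Prod>j\<in>{j \<in> {1..i} - I. j > l}. int (k j))"
      if "l \<in> I \<inter> {1..i}" for l
    proof -
      have "{j \<in> insert (Suc i) ({1..i} - I). j > l} = insert (Suc i) {j \<in> {1..i} - I. j > l}"
        using that by auto
      then show ?thesis by simp
    qed
    have "(\<Prod>l\<in>I \<inter> {1..i}. int N - int s * int (a l) *
          (\<Prod>j\<in>{j \<in> insert (Suc i) ({1..i} - I). j > l}. int (k j))) =
        (\<Prod>l\<in>I \<inter> {1..i}. int N - int (s * k (Suc i)) * int (a l) *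
          (\<Prod>j\<in>{j \<in> {1..i} - I. j > l}. int (k j)))"
      by (intro prod.cong refl) (simp only: split of_nat_mult mult_ac)
    then show ?thesis using Suc.IH[OF pos] False by (simp add: sets del: One_nat_def)
  qed
qed simp

text \<open>Restriction to the torus does not change weights, so bounds for functions carry over to
  codewords. \<open>D > 0\<close> makes the function attaining \<open>D\<close> a nonzero
  codeword.\<close>

lemma min_distance_toric_code:
  fixes P :: "(nat \<Rightarrow>\<^sub>0 real) set"
  assumes "\<And>g :: (nat \<Rightarrow> 'a) \<Rightarrow> 'a. g \<in> eval_space (lattice_exponents P) \<Longrightarrow>
      \<exists>\<xi>\<in>torus n. g \<xi> \<noteq> 0 \<Longrightarrow> D \<le> weight (torus n) g"
    and "\<exists>g :: (nat \<Rightarrow> 'a) \<Rightarrow> 'a. g \<in> eval_space (lattice_exponents P) \<and> weight (torus n) g = D"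
    and "D > 0"
  shows "min_distance (torus n) (toric_code n P :: ((nat \<Rightarrow> 'a::{field,finite}) \<Rightarrow> 'a) set) = D"
proof -
  have code: "toric_code n P = (\<lambda>g :: (nat \<Rightarrow> 'a) \<Rightarrow> 'a. restrict g (torus n)) ` eval_space (lattice_exponents P)"
    by (auto simp: toric_code_def eval_space_def poly_space_def image_image)
  have weight: "weight (torus n) (restrict g (torus n)) = weight (torus n) g"
    for g :: "(nat \<Rightarrow> 'a) \<Rightarrow> 'a"
    unfolding weight_def by (rule arg_cong[where f = card]) auto
  let ?W = "{weight (torus n) c | c :: (nat \<Rightarrow> 'a) \<Rightarrow> 'a.
      c \<in> toric_code n P \<and> (\<exists>s\<in>torus n. c s \<noteq> 0)}"
  have W: "?W = {weight (torus n) g | g :: (nat \<Rightarrow> 'a) \<Rightarrow> 'a.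
      g \<in> eval_space (lattice_exponents P) \<and> (\<exists>\<xi>\<in>torus n. g \<xi> \<noteq> 0)}"
  proof -
    have "(\<exists>\<xi>\<in>torus n. restrict g (torus n) \<xi> \<noteq> 0) \<longleftrightarrow> (\<exists>\<xi>\<in>torus n. g \<xi> \<noteq> 0)" for g :: "(nat \<Rightarrow> 'a) \<Rightarrow> 'a"
      by (intro bex_cong) auto
    moreover have "?W = {weight (torus n) (restrict g (torus n)) | g :: (nat \<Rightarrow> 'a) \<Rightarrow> 'a.
        g \<in> eval_space (lattice_exponents P) \<and> (\<exists>\<xi>\<in>torus n. restrict g (torus n) \<xi> \<noteq> 0)}"
      unfolding code by blast
    ultimately show ?thesis by (simp only: weight)
  qed
  \<comment> \<open>\<open>Min\<close> is meaningful only on a finite set; the size of the torus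
    bounds all weights.\<close>
  have "weight (torus n) g \<le> card (torus n :: (nat \<Rightarrow> 'a) set)" for g :: "(nat \<Rightarrow> 'a) \<Rightarrow> 'a"
    unfolding weight_def by (intro card_mono finite_torus) auto
  then have "finite ?W"
    by (intro finite_subset[of ?W "{..card (torus n :: (nat \<Rightarrow> 'a) set)}"]) auto
  moreover have "D \<in> ?W"
  proof -
    obtain g :: "(nat \<Rightarrow> 'a) \<Rightarrow> 'a" where g: "g \<in> eval_space (lattice_exponents P)" "weight (torus n) g = D"
      using assms(2) by blast
    then have "{\<xi> \<in> torus n. g \<xi> \<noteq> 0} \<noteq> {}"
      using assms(3) unfolding weight_def by (metis card.empty less_irrefl)
    then have "\<exists>\<xi>\<in>torus n. g \<xi> \<noteq> 0" by blast
    with g show ?thesis unfolding W by blast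
  qed
  moreover have "D \<le> w" if "w \<in> ?W" for w
    using that assms(1) unfolding W by blast
  ultimately show ?thesis unfolding min_distance_def by (intro Min_eqI)
qed

theorem theorem3p1:
  fixes q n :: nat
    and P :: "(nat \<Rightarrow>\<^sub>0 real) set"
    and Q :: "nat \<Rightarrow> (nat \<Rightarrow>\<^sub>0 real) set"
    and I J :: "nat set"
    and a k :: "nat \<Rightarrow> nat"
  assumes "q = CARD('a::{field, finite})"
    and "n \<ge> 1"
    and "lattice_polytope n P"
    and "P \<subseteq> cube q n"
    and "I \<subseteq> {1..n}"
    and "J = {1..n} - I"
    and "1 \<in> I"
    and "\<And>i. i \<in> I \<Longrightarrow> a i > 0"
    and "\<And>j. j \<in> J \<Longrightarrow> k j > 0"
    and "Q 0 = {0}"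
    and "\<And>i. i \<in> I \<Longrightarrow> Q i = times_segment (i - 1) (Q (i - 1)) (a i)"
    and "\<And>j. j \<in> J \<Longrightarrow> Q j = dilate (k j) (unit_pyramid (j - 1) (Q (j - 1)))"
    and "P = Q n"
  shows "int (min_distance (torus n) (toric_code n P :: ((nat \<Rightarrow> 'a) \<Rightarrow> 'a) set)) =
           (int q - 1) ^ card J *
           (\<Prod>i\<in>I. int q - 1 - int (a i) * (\<Prod>j\<in>{j \<in> J. j > i}. int (k j)))"
proof -
  let ?N = "CARD('a) - 1"
  have card: "2 \<le> CARD('a)"
    using card_mono[of "UNIV :: 'a set" "{0, 1}"] by simp
  have Q: "Q n \<subseteq> euclid n \<and> convex (Q n) \<and> Q n \<noteq> {} \<and>
      (\<forall>s. lattice_exponents (dilate s (Q n)) = exponents I a k n s)"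
    by (rule polytope_sequence[where n = n]) (use assms in auto)
  have "dilate 1 (Q n) = Q n" by (simp add: dilate_def)
  with Q have E: "lattice_exponents P = exponents I a k n 1"
    using assms(13) by metis
  \<comment> \<open>The cube bounds the first \<open>n\<close> coordinates by \<open>q - 2\<close>,
    one less than \<open>?N\<close>; all others vanish.\<close>
  have "Poly_Mapping.lookup m l < ?N" if "m \<in> exponents I a k n 1" for m l
  proof (cases "l < n")
    case True
    have "Poly_Mapping.map real m \<in> cube q n"
      using that assms(4) unfolding E[symmetric] lattice_exponents_def by blast
    then have "real (Poly_Mapping.lookup m l) \<le> real q - 2"
      using True by (auto simp: cube_def)
    with card show ?thesis using assms(1) by linarith
  next
    case False
    then have "Poly_Mapping.lookup m l = 0"
      using keys_exponents[OF that] by (auto simp: in_keys_iff)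
    with card show ?thesis by simp
  qed
  then have pos: "distance I a k ?N n 1 > 0"
    using card by (intro distance_pos) auto
  have "min_distance (torus n) (toric_code n P :: ((nat \<Rightarrow> 'a) \<Rightarrow> 'a) set) = distance I a k ?N n 1"
  proof (rule min_distance_toric_code)
    fix g :: "(nat \<Rightarrow> 'a) \<Rightarrow> 'a"
    assume "g \<in> eval_space (lattice_exponents P)" "\<exists>\<xi>\<in>torus n. g \<xi> \<noteq> 0"
    then show "distance I a k ?N n 1 \<le> weight (torus n) g"
      using assms(6-9) by (intro distance_le_weight[where n = n]) (auto simp: E)
  qed (use distance_attained[OF pos] pos E in auto)
  moreover have "I \<inter> {1..n} = I" using assms(5) by blast
  moreover have "int ?N = int q - 1" using card assms(1) by simp
  ultimately show ?thesis
    using distance_eq[OF pos, folded assms(6)] by (simp only: of_nat_1 mult_1)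
qed

end
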